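(* Let $n\ge 2$, $\lambda\in\mathbb{R}$, let $\mu$ be a positive Borel measure on $S^{n-1}$, and let $u(x)=\int_{S^{n-1}}P_\lambda(x,\xi)\,d\mu(\xi)$, $x\in B^n$, be the positive invariant harmonic function in $B^n$ defined by $\mu$ with the Poisson kernel $P_\lambda$. Let $\zeta\in S^{n-1}$. (1) If $\lambda>-\frac n2$, then the function $r\mapsto \dfrac{(1-r)^{n-1}}{(1+r)^{1+2\lambda}}u(r\zeta)$ is decreasing for $0\le r<1$, and the function $r\mapsto \dfrac{(1+r)^{n-1}}{(1-r)^{1+2\lambda}}u(r\zeta)$ is increasing for $0\le r<1$. (2) If $\lambda<-\frac n2$, then the function $r\mapsto \dfrac{(1-r)^{n-1}}{(1+r)^{1+2\lambda}}u(r\zeta)$ is increasing for $0\le r<1$, and the function $r\mapsto \dfrac{(1+r)^{n-1}}{(1-r)^{1+2\lambda}}u(r\zeta)$ is decreasing for $0\le r<1$. (3) As $r\to1$ from below, $$\lim_{r\to 1}(1-r)^{n-1}u(r\zeta)=\begin{cases}2^{1+2\lambda}\mu(\{\zeta\}), & \lambda>-\frac n2,\\ \infty, & \lambda<-\frac n2 \text{ and } \mu(\{\zeta\}^c)>0,\\ 2^{1+2\lambda}\mu(\{\zeta\}), & \lambda<-\frac n2\text{ and }\mu(\{\zeta\}^c)=0.\end{cases}$$ (4) As $r\to 1$ from below, $$\lim_{r\to 1}\frac{u(r\zeta)}{(1-r)^{1+2\lambda}}=\int_{S^{n-1}}\frac{2^{1+2\lambda}}{|\zeta-\xi|^{n+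2\lambda}}\,d\mu(\xi).$$
   Context: $B^n=\{x\in\mathbb{R}^n:|x|<1\}$, $S^{n-1}=\partial B^n$. The Poisson kernel is $P_\lambda(x,\zeta)=\dfrac{(1-|x|^2)^{1+2\lambda}}{|x-\zeta|^{n+2\lambda}}$ for $x\in B^n$, $\zeta\in S^{n-1}$. Invariant harmonic functions are the solutions of $\Delta_\lambda u=0$, where $\Delta_\lambda=(1-|x|^2)\left\{\frac{1-|x|^2}{4}\sum_j\frac{\partial^2}{\partial x_j^2}+\lambda\sum_j x_j\frac{\partial}{\partial x_j}+\lambda\left(\frac n2-1-\lambda\right)\right\}$; integrals of $P_\lambda$ against $\mu$ are known to be invariant harmonic. That $u$ is a positive function means $0<u(x)<\infty$ for all $x\in B^n$ (so $\mu$ is finite and nonzero). "Decreasing" and "increasing" are meant in the weak (non-strict) sense. $\{\zeta\}^c=S^{n-1}\setminus\{\zeta\}$. The integral and limit in (4) take values in $[0,\infty]$; at $\xi=\zeta$ the factor $|\zeta-\xi|^{-(n+2\lambda)}$ is $+\infty$, $1$, or $0$ according to whether $n+2\lambda$ is positive, zero, or negative (with $\infty\cdot 0=0$ in the integral). *)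

theory Defs
  imports "HOL-Analysis.Analysis"
begin

definition poisson_kernel :: "real \<Rightarrow> real ^ 'n \<Rightarrow> real ^ 'n \<Rightarrow> real" where
  "poisson_kernel lam x \<xi> =
     (1 - (norm x)\<^sup>2) powr (1 + 2 * lam) / norm (x - \<xi>) powr (real CARD('n) + 2 * lam)"

text \<open>A priori \<open>[0,\<infinity>]\<close>-valued, since the measure is not assumed to be finite.\<close>

definition poisson_integral :: "real \<Rightarrow> (real ^ 'n) measure \<Rightarrow> real ^ 'n \<Rightarrow> ennreal" where
  "poisson_integral lam \<mu> x = (\<integral>\<^sup>+ \<xi>. ennreal (poisson_kernel lam x \<xi>) \<partial>\<mu>)"

text \<open>
  The power \<open>t\<^sup>a\<close> for \<open>t \<ge> 0\<close>, with its limiting value in \<open>[0,\<infinity>]\<close> at \<open>t = 0\<close>: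
  \<open>\<infinity>\<close>, \<open>1\<close> or \<open>0\<close> for \<open>a < 0\<close>, \<open>a = 0\<close>, \<open>a > 0\<close>.
  The library function instead satisfies \<open>0 powr a = 0\<close> for every \<open>a\<close>.
\<close>

definition epowr :: "real \<Rightarrow> real \<Rightarrow> ennreal" where
  "epowr t a =
     (if t = 0 then (if a < 0 then \<infinity> else if a = 0 then 1 else 0) else ennreal (t powr a))"

end

theory Submission imports Defs begin

text \<open>
  Write \<open>a = n + 2\<lambda>\<close>. Multiplied by the two normalising factors of the theorem, the Poisson kernel
  becomes a pure power of a ratio of distances:
  \<^item> the factor \<open>(1 - r)\<^sup>n\<^sup>-\<^sup>1 / (1 + r)\<^sup>1\<^sup>+\<^sup>2\<^sup>\<lambda>\<close> turns \<open>P\<^sub>\<lambda>(r\<zeta>, \<xi>)\<close> into \<open>((1 - r) / |r\<zeta> - \<xi>|)\<^sup>a\<close>;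
  \<^item> the factor \<open>(1 + r)\<^sup>n\<^sup>-\<^sup>1 / (1 - r)\<^sup>1\<^sup>+\<^sup>2\<^sup>\<lambda>\<close> turns it into \<open>(|r\<zeta> - \<xi>| / (1 + r))\<^sup>-\<^sup>a\<close>.

  Here \<open>1 - r\<close> and \<open>1 + r\<close> are the least and the greatest distance of \<open>r\<zeta>\<close> from the sphere. Both
  bases lie in \<open>[0, 1]\<close> and decrease in \<open>r\<close>, for every \<open>\<xi>\<close> on the sphere
  (\<open>near_ratio_antimono\<close>, \<open>far_ratio_antimono\<close>). So each power is monotone in \<open>r\<close>, in a direction
  that depends only on the sign of \<open>a\<close>, and integration against \<open>\<mu>\<close> preserves this. That is the
  monotonicity part of the theorem.

  As \<open>r \<longlongrightarrow> 1\<close>, the first base tends to the indicator of \<open>{\<zeta>}\<close> and the second one to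
  \<open>|\<zeta> - \<xi>| / 2\<close>. Monotonicity lets the limit pass under the integral: by monotone convergence when
  the powers increase, and by dominated convergence when they decrease, where the integrand at
  \<open>r = 0\<close> is the majorant (\<open>nn_integral_epowr_tendsto\<close>). With \<open>0\<^sup>a\<close> read in \<open>[0,\<infinity>]\<close>, the limit of the
  first integral is \<open>\<mu>{\<zeta>} + 0\<^sup>a \<mu>({\<zeta>}\<^sup>c)\<close>, which contains all three cases of the point mass formula.
  The remaining factors \<open>(1 + r)\<^sup>1\<^sup>+\<^sup>2\<^sup>\<lambda>\<close> and \<open>(1 + r)\<^sup>1\<^sup>-\<^sup>n\<close> are continuous at \<open>r = 1\<close>.
\<close>

section \<open>Powers with values in \<open>[0,\<infinity>]\<close>\<close>

lemma epowr_pos: "0 < t \<Longrightarrow> epowr t c = ennreal (t powr c)"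
  by (simp add: epowr_def)

lemma epowr_one [simp]: "epowr 1 c = 1"
  by (simp add: epowr_def)

lemma epowr_mono: "0 \<le> c \<Longrightarrow> 0 \<le> s \<Longrightarrow> s \<le> t \<Longrightarrow> epowr s c \<le> epowr t c"
  by (auto simp: epowr_def intro!: ennreal_leI powr_mono2)

lemma epowr_antimono: "c \<le> 0 \<Longrightarrow> 0 \<le> s \<Longrightarrow> s \<le> t \<Longrightarrow> epowr t c \<le> epowr s c"
  by (auto simp: epowr_def intro!: ennreal_leI powr_mono2')

lemma epowr_mult:
  assumes "0 \<le> t" "0 < k"
  shows "epowr (t * k) c = ennreal (k powr c) * epowr t c"
  using assms
  by (auto simp: epowr_def powr_mult ennreal_mult mult.commute ennreal_mult_top)

lemma borel_measurable_epowr [measurable]: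
  assumes [measurable]: "f \<in> borel_measurable M"
  shows "(\<lambda>x. epowr (f x) c) \<in> borel_measurable M"
  unfolding epowr_def by measurable

text \<open>
  Unlike \<open>powr\<close>, this power is continuous at \<open>0\<close> also for exponents \<open>c \<le> 0\<close>, because for \<open>c < 0\<close> it
  is the \<open>[0,\<infinity>]\<close>-valued reciprocal of the power with exponent \<open>- c\<close>.
\<close>
lemma tendsto_epowr:
  assumes f: "(f \<longlongrightarrow> t) F" and nonneg: "eventually (\<lambda>x. 0 \<le> f x) F" and t: "0 \<le> t"
  shows "((\<lambda>x. epowr (f x) c) \<longlongrightarrow> epowr t c) F"
proof -
  have pos: "((\<lambda>x. epowr (f x) d) \<longlongrightarrow> epowr t d) F" if "0 < d" for d
  proof -
    have eq: "epowr = (\<lambda>s b. if 0 < b then ennreal (s powr b) else epowr s b)"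
      by (auto simp: epowr_def fun_eq_iff)
    have "((\<lambda>x. f x powr d) \<longlongrightarrow> t powr d) F"
      using f nonneg that by (intro tendsto_powr' tendsto_const) auto
    then show ?thesis
      by (subst (1 2) eq) (simp add: that)
  qed
  consider "0 < c" | "c = 0" | "c < 0" by linarith
  then show ?thesis
  proof cases
    case 2
    have "epowr s 0 = 1" for s by (simp add: epowr_def)
    then show ?thesis using 2 by simp
  next
    case 3
    have reciprocal: "epowr s c = inverse (epowr s (- c))" if "0 \<le> s" for s
      using 3 that by (auto simp: epowr_def inverse_ennreal powr_minus)
    have "((\<lambda>x. inverse (epowr (f x) (- c))) \<longlongrightarrow> inverse (epowr t (- c))) F"
      using 3 by (intro continuous_on_tendsto_compose
          [OF continuous_on_inverse_ennreal[OF continuous_on_id, of UNIV]] pos) auto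
    moreover have "eventually (\<lambda>x. inverse (epowr (f x) (- c)) = epowr (f x) c) F"
      using nonneg by eventually_elim (simp add: reciprocal)
    ultimately show ?thesis
      using t by (simp add: reciprocal tendsto_cong)
  qed (use pos in simp)
qed

text \<open>
  Every power of a decreasing family is monotone, so one of the two convergence theorems for
  integrals always applies. When \<open>0 \<le> c\<close> the powers decrease, and the one at \<open>r = 0\<close> is the integrable
  majorant; when \<open>c < 0\<close> they increase, possibly to an integral with value \<open>\<infinity>\<close>.
\<close>
lemma nn_integral_epowr_tendsto:
  fixes p :: "real \<Rightarrow> 'a \<Rightarrow> real"
  assumes meas [measurable]: "\<And>r. p r \<in> borel_measurable M" "q \<in> borel_measurable M"
    and nonneg: "\<And>r x. 0 \<le> r \<Longrightarrow> r < 1 \<Longrightarrow> x \<in> space M \<Longrightarrow> 0 \<le> p r x"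
    and decr: "\<And>r s x. 0 \<le> r \<Longrightarrow> r \<le> s \<Longrightarrow> s < 1 \<Longrightarrow> x \<in> space M \<Longrightarrow> p s x \<le> p r x"
    and lim: "\<And>x. x \<in> space M \<Longrightarrow> ((\<lambda>r. p r x) \<longlongrightarrow> q x) (at_left 1)"
    and fin: "(\<integral>\<^sup>+x. epowr (p 0 x) c \<partial>M) < \<infinity>"
  shows "((\<lambda>r. \<integral>\<^sup>+x. epowr (p r x) c \<partial>M) \<longlongrightarrow> (\<integral>\<^sup>+x. epowr (q x) c \<partial>M)) (at_left 1)"
proof (rule tendsto_at_left_sequentially[of 0])
  fix S :: "nat \<Rightarrow> real"
  assume S1: "\<And>n. S n < 1" and S0: "\<And>n. 0 < S n" and inc: "incseq S" and S: "S \<longlonglongrightarrow> 1"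
  have ptw: "(\<lambda>n. epowr (p (S n) x) c) \<longlonglongrightarrow> epowr (q x) c" if x: "x \<in> space M" for x
  proof (rule tendsto_epowr)
    have "filterlim S (at_left 1) sequentially"
      using S S1 by (auto simp: filterlim_at intro!: always_eventually) (metis less_irrefl)
    from filterlim_compose[OF lim[OF x] this] show l: "(\<lambda>n. p (S n) x) \<longlonglongrightarrow> q x" .
    show "\<forall>\<^sub>F n in sequentially. 0 \<le> p (S n) x"
      using nonneg[OF less_imp_le[OF S0] S1 x] by simp
    then show "0 \<le> q x"
      by (intro tendsto_lowerbound[OF l]) auto
  qed
  show "(\<lambda>n. \<integral>\<^sup>+x. epowr (p (S n) x) c \<partial>M) \<longlonglongrightarrow> (\<integral>\<^sup>+x. epowr (q x) c \<partial>M)"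
  proof (cases "0 \<le> c")
    case True
    have "epowr (p (S n) x) c \<le> epowr (p 0 x) c" if "x \<in> space M" for n x
      using that S0[of n] S1[of n] True by (intro epowr_mono nonneg decr) auto
    then show ?thesis
      using fin ptw by (intro nn_integral_dominated_convergence[where w = "\<lambda>x. epowr (p 0 x) c"]) auto
  next
    case False
    have mono: "epowr (p (S m) x) c \<le> epowr (p (S n) x) c" if "x \<in> space M" "m \<le> n" for m n x
      using that S0[of m] S0[of n] S1[of n] False incseqD[OF inc \<open>m \<le> n\<close>]
      by (intro epowr_antimono nonneg decr) auto
    have "(SUP n. epowr (p (S n) x) c) = epowr (q x) c" if x: "x \<in> space M" for x
      using LIMSEQ_SUP[of "\<lambda>n. epowr (p (S n) x) c"] mono[OF x] ptw[OF x]
      by (auto simp: incseq_def intro: LIMSEQ_unique)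
    then have "(\<integral>\<^sup>+x. epowr (q x) c \<partial>M) = (\<integral>\<^sup>+x. (SUP n. epowr (p (S n) x) c) \<partial>M)"
      by (intro nn_integral_cong) simp
    also have "\<dots> = (SUP n. \<integral>\<^sup>+x. epowr (p (S n) x) c \<partial>M)"
      by (intro nn_integral_monotone_convergence_SUP_AE AE_I2 mono) auto
    finally show ?thesis
      using LIMSEQ_SUP[of "\<lambda>n. \<integral>\<^sup>+x. epowr (p (S n) x) c \<partial>M"] mono
      by (auto simp: incseq_def intro!: nn_integral_mono)
  qed
qed simp

section \<open>Distances from a point on a radius to the sphere\<close>

definition near_ratio :: "real ^ 'n \<Rightarrow> real \<Rightarrow> real ^ 'n \<Rightarrow> real" where
  "near_ratio \<zeta> r \<xi> = (1 - r) / norm (r *\<^sub>R \<zeta> - \<xi>)"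

definition far_ratio :: "real ^ 'n \<Rightarrow> real \<Rightarrow> real ^ 'n \<Rightarrow> real" where
  "far_ratio \<zeta> r \<xi> = norm (r *\<^sub>R \<zeta> - \<xi>) / (1 + r)"

lemma borel_measurable_near_ratio [measurable]: "near_ratio \<zeta> r \<in> borel_measurable borel"
  unfolding near_ratio_def[abs_def] by measurable

lemma borel_measurable_far_ratio [measurable]: "far_ratio \<zeta> r \<in> borel_measurable borel"
  unfolding far_ratio_def[abs_def] by measurable

lemma norm_radius_diff_pos:
  fixes \<zeta> \<xi> :: "real ^ 'n"
  assumes "norm \<zeta> = 1" "norm \<xi> = 1" "0 \<le> r" "r < 1"
  shows "0 < norm (r *\<^sub>R \<zeta> - \<xi>)"
  using assms by auto

lemma norm_radius_diff_sq:
  fixes \<zeta> \<xi> :: "real ^ 'n"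
  assumes "norm \<zeta> = 1" "norm \<xi> = 1"
  shows "(norm (r *\<^sub>R \<zeta> - \<xi>))\<^sup>2 = 1 - 2 * r * (\<zeta> \<bullet> \<xi>) + r\<^sup>2"
  using assms unfolding power2_norm_eq_inner
  by (simp add: inner_diff_left inner_diff_right inner_commute norm_eq_1 power2_eq_square
      algebra_simps)

lemma near_ratio_nonneg: "r < 1 \<Longrightarrow> 0 \<le> near_ratio \<zeta> r \<xi>"
  by (simp add: near_ratio_def)

lemma far_ratio_nonneg: "0 \<le> r \<Longrightarrow> 0 \<le> far_ratio \<zeta> r \<xi>"
  by (simp add: far_ratio_def)

text \<open>
  With \<open>t = \<zeta> \<bullet> \<xi>\<close>, the squared reciprocal of the ratio is \<open>1 + 2 (1 - t) r / (1 - r)\<^sup>2\<close>, where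
  \<open>1 - t \<ge> 0\<close> and \<open>r / (1 - r)\<^sup>2\<close> increases in \<open>r\<close>.
\<close>
lemma near_ratio_antimono:
  fixes \<zeta> \<xi> :: "real ^ 'n"
  assumes norms: "norm \<zeta> = 1" "norm \<xi> = 1" and rs: "0 \<le> r" "r \<le> s" "s < 1"
  shows "near_ratio \<zeta> s \<xi> \<le> near_ratio \<zeta> r \<xi>"
proof -
  have t: "\<zeta> \<bullet> \<xi> \<le> 1"
    using norm_cauchy_schwarz[of \<zeta> \<xi>] norms by simp
  have "(1 - r)\<^sup>2 * (norm (s *\<^sub>R \<zeta> - \<xi>))\<^sup>2 - (1 - s)\<^sup>2 * (norm (r *\<^sub>R \<zeta> - \<xi>))\<^sup>2
      = 2 * (1 - \<zeta> \<bullet> \<xi>) * ((s - r) * (1 - r * s))"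
    unfolding norm_radius_diff_sq[OF norms] by (simp add: power2_eq_square algebra_simps)
  moreover have "0 \<le> 2 * (1 - \<zeta> \<bullet> \<xi>) * ((s - r) * (1 - r * s))"
    using t rs by (intro mult_nonneg_nonneg) (auto simp: mult_le_one)
  ultimately have "((1 - s) * norm (r *\<^sub>R \<zeta> - \<xi>))\<^sup>2 \<le> ((1 - r) * norm (s *\<^sub>R \<zeta> - \<xi>))\<^sup>2"
    by (simp add: power_mult_distrib)
  then have "(1 - s) * norm (r *\<^sub>R \<zeta> - \<xi>) \<le> (1 - r) * norm (s *\<^sub>R \<zeta> - \<xi>)"
    using rs by (auto intro: power2_le_imp_le)
  then show ?thesis
    using norm_radius_diff_pos[OF norms, of r] norm_radius_diff_pos[OF norms, of s] rs
    by (simp add: near_ratio_def divide_le_eq le_divide_eq)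
qed

text \<open>
  With \<open>t = \<zeta> \<bullet> \<xi>\<close>, the squared ratio is \<open>1 - 2 (1 + t) r / (1 + r)\<^sup>2\<close>, where \<open>1 + t \<ge> 0\<close> and
  \<open>r / (1 + r)\<^sup>2\<close> increases in \<open>r\<close> on \<open>[0, 1]\<close>.
\<close>
lemma far_ratio_antimono:
  fixes \<zeta> \<xi> :: "real ^ 'n"
  assumes norms: "norm \<zeta> = 1" "norm \<xi> = 1" and rs: "0 \<le> r" "r \<le> s" "s < 1"
  shows "far_ratio \<zeta> s \<xi> \<le> far_ratio \<zeta> r \<xi>"
proof -
  have t: "- 1 \<le> \<zeta> \<bullet> \<xi>"
    using Cauchy_Schwarz_ineq2[of \<zeta> \<xi>] norms by simp
  have "(1 + s)\<^sup>2 * (norm (r *\<^sub>R \<zeta> - \<xi>))\<^sup>2 - (1 + r)\<^sup>2 * (norm (s *\<^sub>R \<zeta> - \<xi>))\<^sup>2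
      = 2 * (1 + \<zeta> \<bullet> \<xi>) * ((s - r) * (1 - r * s))"
    unfolding norm_radius_diff_sq[OF norms] by (simp add: power2_eq_square algebra_simps)
  moreover have "0 \<le> 2 * (1 + \<zeta> \<bullet> \<xi>) * ((s - r) * (1 - r * s))"
    using t rs by (intro mult_nonneg_nonneg) (auto simp: mult_le_one)
  ultimately have "((1 + r) * norm (s *\<^sub>R \<zeta> - \<xi>))\<^sup>2 \<le> ((1 + s) * norm (r *\<^sub>R \<zeta> - \<xi>))\<^sup>2"
    by (simp add: power_mult_distrib)
  then have "(1 + r) * norm (s *\<^sub>R \<zeta> - \<xi>) \<le> (1 + s) * norm (r *\<^sub>R \<zeta> - \<xi>)"
    using rs by (auto intro: power2_le_imp_le)
  then show ?thesis
    using rs by (simp add: far_ratio_def divide_le_eq le_divide_eq mult.commute)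
qed

lemma near_ratio_tendsto:
  fixes \<zeta> \<xi> :: "real ^ 'n"
  assumes "norm \<zeta> = 1"
  shows "((\<lambda>r. near_ratio \<zeta> r \<xi>) \<longlongrightarrow> indicator {\<zeta>} \<xi>) (at_left 1)"
proof (cases "\<xi> = \<zeta>")
  case True
  have "near_ratio \<zeta> r \<zeta> = 1" if "r < 1" for r
  proof -
    have "norm (r *\<^sub>R \<zeta> - \<zeta>) = norm ((r - 1) *\<^sub>R \<zeta>)"
      by (simp add: algebra_simps)
    then show ?thesis
      using that assms by (simp add: near_ratio_def)
  qed
  then have "\<forall>\<^sub>F r in at_left 1. near_ratio \<zeta> r \<xi> = 1"
    using True by (auto simp: eventually_at_filter)
  then show ?thesis
    using True by (simp add: tendsto_eventually)
next
  case False
  then have "((\<lambda>r. (1 - r) / norm (r *\<^sub>R \<zeta> - \<xi>)) \<longlongrightarrow> (1 - 1) / norm (1 *\<^sub>R \<zeta> - \<xi>)) (at_left 1)"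
    by (intro tendsto_intros) auto
  then show ?thesis
    using False by (simp add: near_ratio_def)
qed

lemma far_ratio_tendsto:
  "((\<lambda>r. far_ratio \<zeta> r \<xi>) \<longlongrightarrow> norm (\<zeta> - \<xi>) * (1 / 2)) (at_left 1)"
proof -
  have "((\<lambda>r. norm (r *\<^sub>R \<zeta> - \<xi>) / (1 + r)) \<longlongrightarrow> norm (1 *\<^sub>R \<zeta> - \<xi>) / (1 + 1)) (at_left 1)"
    by (intro tendsto_intros) auto
  then show ?thesis
    by (simp add: far_ratio_def)
qed

section \<open>The normalised Poisson kernel\<close>

context
  fixes \<zeta> \<xi> :: "real ^ 'n" and r lam :: real
  assumes norms: "norm \<zeta> = 1" "norm \<xi> = 1" and r: "0 \<le> r" "r < 1"
begin

lemma poisson_kernel_radius: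
  "poisson_kernel lam (r *\<^sub>R \<zeta>) \<xi> =
     (1 - r) powr (1 + 2 * lam) * (1 + r) powr (1 + 2 * lam)
       / norm (r *\<^sub>R \<zeta> - \<xi>) powr (real CARD('n) + 2 * lam)"
proof -
  have "1 - (norm (r *\<^sub>R \<zeta>))\<^sup>2 = (1 - r) * (1 + r)"
    using norms r by (simp add: power2_eq_square algebra_simps)
  then show ?thesis
    using r by (simp add: poisson_kernel_def powr_mult)
qed

lemma near_normalised_poisson_kernel:
  "ennreal ((1 - r) ^ (CARD('n) - 1) / (1 + r) powr (1 + 2 * lam) * poisson_kernel lam (r *\<^sub>R \<zeta>) \<xi>)
     = epowr (near_ratio \<zeta> r \<xi>) (real CARD('n) + 2 * lam)"
proof -
  have d: "0 < norm (r *\<^sub>R \<zeta> - \<xi>)"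
    by (rule norm_radius_diff_pos[OF norms r])
  have exponent: "real CARD('n) + 2 * lam = real (CARD('n) - 1) + (1 + 2 * lam)"
    by (simp add: of_nat_diff Suc_le_eq)
  have "(1 - r) powr (real CARD('n) + 2 * lam) = (1 - r) ^ (CARD('n) - 1) * (1 - r) powr (1 + 2 * lam)"
    using r unfolding exponent powr_add by (simp add: powr_realpow del: of_nat_diff One_nat_def)
  then have "(1 - r) ^ (CARD('n) - 1) / (1 + r) powr (1 + 2 * lam) * poisson_kernel lam (r *\<^sub>R \<zeta>) \<xi>
      = near_ratio \<zeta> r \<xi> powr (real CARD('n) + 2 * lam)"
    using r d by (simp add: poisson_kernel_radius near_ratio_def powr_divide)
  then show ?thesis
    using r d by (simp add: epowr_pos near_ratio_def)
qed

lemma far_normalised_poisson_kernel: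
  "ennreal ((1 + r) ^ (CARD('n) - 1) / (1 - r) powr (1 + 2 * lam) * poisson_kernel lam (r *\<^sub>R \<zeta>) \<xi>)
     = epowr (far_ratio \<zeta> r \<xi>) (- (real CARD('n) + 2 * lam))"
proof -
  have d: "0 < norm (r *\<^sub>R \<zeta> - \<xi>)"
    by (rule norm_radius_diff_pos[OF norms r])
  have exponent: "real CARD('n) + 2 * lam = real (CARD('n) - 1) + (1 + 2 * lam)"
    by (simp add: of_nat_diff Suc_le_eq)
  have "(1 + r) powr (real CARD('n) + 2 * lam) = (1 + r) ^ (CARD('n) - 1) * (1 + r) powr (1 + 2 * lam)"
    using r unfolding exponent powr_add by (simp add: powr_realpow del: of_nat_diff One_nat_def)
  then have "(1 + r) ^ (CARD('n) - 1) / (1 - r) powr (1 + 2 * lam) * poisson_kernel lam (r *\<^sub>R \<zeta>) \<xi>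
      = (1 / far_ratio \<zeta> r \<xi>) powr (real CARD('n) + 2 * lam)"
    using r d by (simp add: poisson_kernel_radius far_ratio_def powr_divide)
  also have "\<dots> = far_ratio \<zeta> r \<xi> powr - (real CARD('n) + 2 * lam)"
    using r d by (subst powr_minus_divide) (simp add: far_ratio_def powr_divide)
  finally show ?thesis
    using r d by (simp add: epowr_pos far_ratio_def)
qed

end

section \<open>Radial behaviour of the Poisson integral\<close>

theorem theorem1p1:
  fixes lam :: real
    and \<mu> :: "(real ^ 'n) measure"
    and u :: "real ^ 'n \<Rightarrow> real"
    and \<zeta> :: "real ^ 'n"
  assumes dim: "CARD('n) \<ge> 2"
    and borel_sphere: "sets \<mu> = sets (restrict_space borel (sphere 0 1))"
    and u_eq: "\<And>x. x \<in> ball 0 1 \<Longrightarrow> ennreal (u x) = poisson_integral lam \<mu> x"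
    and u_pos: "\<And>x. x \<in> ball 0 1 \<Longrightarrow> 0 < u x"
    and zeta: "\<zeta> \<in> sphere 0 1"
  shows
    "(lam > - real CARD('n) / 2 \<longrightarrow>
        antimono_on {0..<1}
          (\<lambda>r. (1 - r) ^ (CARD('n) - 1) / (1 + r) powr (1 + 2 * lam) * u (r *\<^sub>R \<zeta>)) \<and>
        mono_on {0..<1}
          (\<lambda>r. (1 + r) ^ (CARD('n) - 1) / (1 - r) powr (1 + 2 * lam) * u (r *\<^sub>R \<zeta>)))
     \<and>
     (lam < - real CARD('n) / 2 \<longrightarrow>
        mono_on {0..<1}
          (\<lambda>r. (1 - r) ^ (CARD('n) - 1) / (1 + r) powr (1 + 2 * lam) * u (r *\<^sub>R \<zeta>)) \<and>
        antimono_on {0..<1}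
          (\<lambda>r. (1 + r) ^ (CARD('n) - 1) / (1 - r) powr (1 + 2 * lam) * u (r *\<^sub>R \<zeta>)))
     \<and>
     (lam > - real CARD('n) / 2 \<longrightarrow>
        ((\<lambda>r. ennreal ((1 - r) ^ (CARD('n) - 1) * u (r *\<^sub>R \<zeta>))) \<longlongrightarrow>
           ennreal (2 powr (1 + 2 * lam)) * emeasure \<mu> {\<zeta>}) (at_left 1))
     \<and>
     (lam < - real CARD('n) / 2 \<and> emeasure \<mu> (sphere 0 1 - {\<zeta>}) > 0 \<longrightarrow>
        ((\<lambda>r. ennreal ((1 - r) ^ (CARD('n) - 1) * u (r *\<^sub>R \<zeta>))) \<longlongrightarrow> \<infinity>) (at_left 1))
     \<and>
     (lam < - real CARD('n) / 2 \<and> emeasure \<mu> (sphere 0 1 - {\<zeta>}) = 0 \<longrightarrow>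
        ((\<lambda>r. ennreal ((1 - r) ^ (CARD('n) - 1) * u (r *\<^sub>R \<zeta>))) \<longlongrightarrow>
           ennreal (2 powr (1 + 2 * lam)) * emeasure \<mu> {\<zeta>}) (at_left 1))
     \<and>
     ((\<lambda>r. ennreal (u (r *\<^sub>R \<zeta>) / (1 - r) powr (1 + 2 * lam))) \<longlongrightarrow>
        (\<integral>\<^sup>+ \<xi>. ennreal (2 powr (1 + 2 * lam)) *
               epowr (norm (\<zeta> - \<xi>)) (- (real CARD('n) + 2 * lam)) \<partial>\<mu>)) (at_left 1)"
proof -
  define a where "a = real CARD('n) + 2 * lam"
  have norm_zeta: "norm \<zeta> = 1"
    using zeta by simp
  have space_mu: "space \<mu> = sphere 0 1"
    using sets_eq_imp_space_eq[OF borel_sphere] by (simp add: space_restrict_space)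
  have meas: "f \<in> borel_measurable \<mu>" if "f \<in> borel_measurable borel" for f :: "real ^ 'n \<Rightarrow> 'b::topological_space"
    using measurable_restrict_space1[OF that, of "sphere 0 1"]
    by (simp add: measurable_cong_sets[OF borel_sphere refl])

  let ?N = "\<lambda>r. \<integral>\<^sup>+\<xi>. epowr (near_ratio \<zeta> r \<xi>) a \<partial>\<mu>"
  let ?F = "\<lambda>r. \<integral>\<^sup>+\<xi>. epowr (far_ratio \<zeta> r \<xi>) (- a) \<partial>\<mu>"
  let ?n = "\<lambda>r. (1 - r) ^ (CARD('n) - 1) / (1 + r) powr (1 + 2 * lam) * u (r *\<^sub>R \<zeta>)"
  let ?f = "\<lambda>r. (1 + r) ^ (CARD('n) - 1) / (1 - r) powr (1 + 2 * lam) * u (r *\<^sub>R \<zeta>)"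

  have u_nonneg: "0 \<le> u (r *\<^sub>R \<zeta>)" if "0 \<le> r" "r < 1" for r
    using that norm_zeta by (intro less_imp_le u_pos) simp
  have scaled: "ennreal (k * u (r *\<^sub>R \<zeta>)) = (\<integral>\<^sup>+\<xi>. ennreal (k * poisson_kernel lam (r *\<^sub>R \<zeta>) \<xi>) \<partial>\<mu>)"
    if "0 \<le> r" "r < 1" "0 \<le> k" for k r
  proof -
    have "ennreal (k * u (r *\<^sub>R \<zeta>)) = ennreal k * poisson_integral lam \<mu> (r *\<^sub>R \<zeta>)"
      using that norm_zeta by (simp add: ennreal_mult' u_eq)
    also have "\<dots> = (\<integral>\<^sup>+\<xi>. ennreal k * ennreal (poisson_kernel lam (r *\<^sub>R \<zeta>) \<xi>) \<partial>\<mu>)"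
      unfolding poisson_integral_def
      by (intro nn_integral_cmult[symmetric] meas) (simp add: poisson_kernel_def)
    finally show ?thesis
      using that by (simp add: ennreal_mult')
  qed
  have n_eq: "ennreal (?n r) = ?N r" if "0 \<le> r" "r < 1" for r
    using that norm_zeta space_mu unfolding a_def
    by (subst scaled) (auto intro!: nn_integral_cong simp: near_normalised_poisson_kernel[simplified])
  have f_eq: "ennreal (?f r) = ?F r" if "0 \<le> r" "r < 1" for r
    using that norm_zeta space_mu unfolding a_def
    by (subst scaled) (auto intro!: nn_integral_cong simp: far_normalised_poisson_kernel[simplified])
  have n_nonneg: "0 \<le> ?n r" and f_nonneg: "0 \<le> ?f r" if "0 \<le> r" "r < 1" for r
    using that u_nonneg[OF that] by auto

  have near_decr: "near_ratio \<zeta> s \<xi> \<le> near_ratio \<zeta> r \<xi>"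
    and far_decr: "far_ratio \<zeta> s \<xi> \<le> far_ratio \<zeta> r \<xi>"
    if "0 \<le> r" "r \<le> s" "s < 1" "\<xi> \<in> space \<mu>" for r s \<xi>
    using that norm_zeta space_mu by (auto intro: near_ratio_antimono far_ratio_antimono)

  have mono_pos: "antimono_on {0..<1} ?n \<and> mono_on {0..<1} ?f" if "0 \<le> a"
  proof -
    have "?n s \<le> ?n r" "?f r \<le> ?f s" if rs: "0 \<le> r" "r \<le> s" "s < 1" for r s
    proof -
      have "?N s \<le> ?N r"
        using rs \<open>0 \<le> a\<close>
        by (intro nn_integral_mono epowr_mono near_ratio_nonneg near_decr) auto
      moreover have "?F r \<le> ?F s"
        using rs \<open>0 \<le> a\<close>
        by (intro nn_integral_mono epowr_antimono far_ratio_nonneg far_decr) auto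
      ultimately have "ennreal (?n s) \<le> ennreal (?n r)" "ennreal (?f r) \<le> ennreal (?f s)"
        using rs n_eq[of r] n_eq[of s] f_eq[of r] f_eq[of s] by simp_all
      then show "?n s \<le> ?n r" "?f r \<le> ?f s"
        using rs n_nonneg[of r] f_nonneg[of s] by (simp_all only: ennreal_le_iff)
    qed
    then show ?thesis by (auto simp: monotone_on_def)
  qed
  have mono_neg: "mono_on {0..<1} ?n \<and> antimono_on {0..<1} ?f" if "a \<le> 0"
  proof -
    have "?n r \<le> ?n s" "?f s \<le> ?f r" if rs: "0 \<le> r" "r \<le> s" "s < 1" for r s
    proof -
      have "?N r \<le> ?N s"
        using rs \<open>a \<le> 0\<close>
        by (intro nn_integral_mono epowr_antimono near_ratio_nonneg near_decr) auto
      moreover have "?F s \<le> ?F r"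
        using rs \<open>a \<le> 0\<close>
        by (intro nn_integral_mono epowr_mono far_ratio_nonneg far_decr) auto
      ultimately have "ennreal (?n r) \<le> ennreal (?n s)" "ennreal (?f s) \<le> ennreal (?f r)"
        using rs n_eq[of r] n_eq[of s] f_eq[of r] f_eq[of s] by simp_all
      then show "?n r \<le> ?n s" "?f s \<le> ?f r"
        using rs n_nonneg[of s] f_nonneg[of r] by (simp_all only: ennreal_le_iff)
    qed
    then show ?thesis by (auto simp: monotone_on_def)
  qed

  have N_lim: "(?N \<longlongrightarrow> (\<integral>\<^sup>+\<xi>. epowr (indicator {\<zeta>} \<xi>) a \<partial>\<mu>)) (at_left 1)"
    using n_eq[of 0, symmetric] norm_zeta
    by (intro nn_integral_epowr_tendsto near_ratio_nonneg near_decr near_ratio_tendsto meas)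
      (auto simp del: scaleR_zero_left)
  have F_lim: "(?F \<longlongrightarrow> (\<integral>\<^sup>+\<xi>. epowr (norm (\<zeta> - \<xi>) * (1 / 2)) (- a) \<partial>\<mu>)) (at_left 1)"
    using f_eq[of 0, symmetric]
    by (intro nn_integral_epowr_tendsto far_ratio_nonneg far_decr far_ratio_tendsto meas)
      (auto simp del: scaleR_zero_left)

  have near_radius: "\<forall>\<^sub>F r in at_left (1::real). 0 \<le> r \<and> r < 1"
    using eventually_mono[OF eventually_at_left_real[of 0 1]] by simp
  have factor_lim: "((\<lambda>r. ennreal ((1 + r) powr b)) \<longlongrightarrow> ennreal (2 powr b)) (at_left 1)" for b
  proof -
    have "((\<lambda>r::real. (1 + r) powr b) \<longlongrightarrow> (1 + 1) powr b) (at_left 1)"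
      by (intro tendsto_intros) auto
    then show ?thesis by simp
  qed

  have near_limit: "((\<lambda>r. ennreal ((1 - r) ^ (CARD('n) - 1) * u (r *\<^sub>R \<zeta>))) \<longlongrightarrow>
      ennreal (2 powr (1 + 2 * lam)) *
        (emeasure \<mu> {\<zeta>} + epowr 0 a * emeasure \<mu> (sphere 0 1 - {\<zeta>}))) (at_left 1)"
  proof -
    have sets_mu: "{\<zeta>} \<in> sets \<mu>" "sphere 0 1 - {\<zeta>} \<in> sets \<mu>"
      using zeta by (auto simp: borel_sphere sets_restrict_space_iff)
    have "(\<integral>\<^sup>+\<xi>. epowr (indicator {\<zeta>} \<xi>) a \<partial>\<mu>)
        = (\<integral>\<^sup>+\<xi>. indicator {\<zeta>} \<xi> + epowr 0 a * indicator (sphere 0 1 - {\<zeta>}) \<xi> \<partial>\<mu>)"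
      using space_mu by (intro nn_integral_cong) (auto simp: indicator_def)
    also have "\<dots> = emeasure \<mu> {\<zeta>} + epowr 0 a * emeasure \<mu> (sphere 0 1 - {\<zeta>})"
      using sets_mu by (simp add: nn_integral_add nn_integral_cmult)
    finally have N: "(?N \<longlongrightarrow> emeasure \<mu> {\<zeta>} + epowr 0 a * emeasure \<mu> (sphere 0 1 - {\<zeta>})) (at_left 1)"
      using N_lim by simp
    have "\<forall>\<^sub>F r in at_left 1. ennreal ((1 + r) powr (1 + 2 * lam)) * ?N r
        = ennreal ((1 - r) ^ (CARD('n) - 1) * u (r *\<^sub>R \<zeta>))"
      using near_radius
    proof eventually_elim
      case (elim r)
      then show ?case
        by (subst n_eq[symmetric]) (auto simp: ennreal_mult'[symmetric])
    qed
    with tendsto_mult_ennreal[OF factor_lim N] show ?thesis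
      by (rule_tac Lim_transform_eventually) auto
  qed

  have far_limit: "((\<lambda>r. ennreal (u (r *\<^sub>R \<zeta>) / (1 - r) powr (1 + 2 * lam))) \<longlongrightarrow>
      (\<integral>\<^sup>+\<xi>. ennreal (2 powr (1 + 2 * lam)) * epowr (norm (\<zeta> - \<xi>)) (- a) \<partial>\<mu>)) (at_left 1)"
  proof -
    let ?b = "1 - real CARD('n)"
    have "\<forall>\<^sub>F r in at_left 1. ennreal ((1 + r) powr ?b) * ?F r
        = ennreal (u (r *\<^sub>R \<zeta>) / (1 - r) powr (1 + 2 * lam))"
      using near_radius
    proof eventually_elim
      case (elim r)
      have "(1 + r) powr ?b * (1 + r) ^ (CARD('n) - 1) = (1 + r) powr (?b + real (CARD('n) - 1))"
        using elim unfolding powr_add by (simp add: powr_realpow del: of_nat_diff One_nat_def)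
      also have "\<dots> = 1"
        using elim dim by (simp add: of_nat_diff)
      finally have cancel: "(1 + r) powr ?b * (1 + r) ^ (CARD('n) - 1) = 1" .
      have "ennreal ((1 + r) powr ?b) * ?F r = ennreal ((1 + r) powr ?b * ?f r)"
        using elim by (simp only: ennreal_mult'[OF powr_ge_zero] f_eq)
      also have "(1 + r) powr ?b * ?f r
          = ((1 + r) powr ?b * (1 + r) ^ (CARD('n) - 1)) * (u (r *\<^sub>R \<zeta>) / (1 - r) powr (1 + 2 * lam))"
        by simp
      finally show ?case
        unfolding cancel by simp
    qed
    with tendsto_mult_ennreal[OF factor_lim[of ?b] F_lim]
    have "((\<lambda>r. ennreal (u (r *\<^sub>R \<zeta>) / (1 - r) powr (1 + 2 * lam))) \<longlongrightarrow>
        ennreal (2 powr ?b) * (\<integral>\<^sup>+\<xi>. epowr (norm (\<zeta> - \<xi>) * (1 / 2)) (- a) \<partial>\<mu>)) (at_left 1)"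
      by (rule_tac Lim_transform_eventually) auto
    also have "ennreal (2 powr ?b) * (\<integral>\<^sup>+\<xi>. epowr (norm (\<zeta> - \<xi>) * (1 / 2)) (- a) \<partial>\<mu>)
        = (\<integral>\<^sup>+\<xi>. ennreal (2 powr ?b) * epowr (norm (\<zeta> - \<xi>) * (1 / 2)) (- a) \<partial>\<mu>)"
      by (intro nn_integral_cmult[symmetric] meas) measurable
    also have "\<dots> = (\<integral>\<^sup>+\<xi>. ennreal (2 powr (1 + 2 * lam)) * epowr (norm (\<zeta> - \<xi>)) (- a) \<partial>\<mu>)"
    proof (intro nn_integral_cong)
      fix \<xi>
      have "2 powr ?b * (1 / 2) powr (- a) = (2::real) powr (1 + 2 * lam)"
        by (simp add: a_def powr_divide powr_minus powr_add[symmetric] field_simps)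
      then have "ennreal (2 powr (1 + 2 * lam)) = ennreal (2 powr ?b) * ennreal ((1 / 2) powr (- a))"
        by (metis ennreal_mult' powr_ge_zero)
      then show "ennreal (2 powr ?b) * epowr (norm (\<zeta> - \<xi>) * (1 / 2)) (- a)
          = ennreal (2 powr (1 + 2 * lam)) * epowr (norm (\<zeta> - \<xi>)) (- a)"
        by (subst epowr_mult) (auto simp only: mult.assoc norm_ge_zero)
    qed
    finally show ?thesis .
  qed

  show ?thesis
  proof (intro conjI impI)
    assume lam: "lam > - real CARD('n) / 2"
    then show "antimono_on {0..<1} ?n" "mono_on {0..<1} ?f"
      using mono_pos by (auto simp: a_def)
    have "epowr 0 a = 0"
      using lam by (simp add: epowr_def a_def)
    then show "((\<lambda>r. ennreal ((1 - r) ^ (CARD('n) - 1) * u (r *\<^sub>R \<zeta>))) \<longlongrightarrow>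
        ennreal (2 powr (1 + 2 * lam)) * emeasure \<mu> {\<zeta>}) (at_left 1)"
      using near_limit by simp
  next
    assume lam: "lam < - real CARD('n) / 2"
    then show "mono_on {0..<1} ?n" "antimono_on {0..<1} ?f"
      using mono_neg by (auto simp: a_def)
  next
    assume *: "lam < - real CARD('n) / 2 \<and> emeasure \<mu> (sphere 0 1 - {\<zeta>}) > 0"
    then have "epowr 0 a = \<infinity>" "emeasure \<mu> (sphere 0 1 - {\<zeta>}) \<noteq> 0"
      by (auto simp: epowr_def a_def)
    then show "((\<lambda>r. ennreal ((1 - r) ^ (CARD('n) - 1) * u (r *\<^sub>R \<zeta>))) \<longlongrightarrow> \<infinity>) (at_left 1)"
      using near_limit by (simp add: ennreal_top_mult ennreal_mult_top)
  next
    assume "lam < - real CARD('n) / 2 \<and> emeasure \<mu> (sphere 0 1 - {\<zeta>}) = 0"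
    then show "((\<lambda>r. ennreal ((1 - r) ^ (CARD('n) - 1) * u (r *\<^sub>R \<zeta>))) \<longlongrightarrow>
        ennreal (2 powr (1 + 2 * lam)) * emeasure \<mu> {\<zeta>}) (at_left 1)"
      using near_limit by simp
  next
    show "((\<lambda>r. ennreal (u (r *\<^sub>R \<zeta>) / (1 - r) powr (1 + 2 * lam))) \<longlongrightarrow>
        (\<integral>\<^sup>+ \<xi>. ennreal (2 powr (1 + 2 * lam)) *
           epowr (norm (\<zeta> - \<xi>)) (- (real CARD('n) + 2 * lam)) \<partial>\<mu>)) (at_left 1)"
      using far_limit by (simp add: a_def)
  qed
qed

end
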